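(* Let $G$ be an ordered additive abelian group with order $\preceq$, let $a\in G$ with $0\prec a$, let $h\geq 2$ be an integer, and let $k\geq 3$ be an integer. If $A=\{0,a,2a,\dots,(k-2)a,ka\}$, then $|hA|=hk$.
   Context: An ordered additive abelian group is an additive abelian group $G$ with a total order $\preceq$ such that for all $x,y,z\in G$, $x\prec y$ implies $x+z\prec y+z$ (here $\prec$ means $\preceq$ and $\neq$). For an integer $h\geq 2$ and $A\subseteq G$, the $h$-fold sumset is $hA=\{a_1+\cdots+a_h : a_1,\dots,a_h\in A\}$ (the $a_i$ need not be distinct). For a positive integer $n$, $na$ denotes the sum of $n$ copies of $a$, and $0a=0$. *)

theory Defs
  imports Main
begin

definition nmult :: "nat \<Rightarrow> 'a::comm_monoid_add \<Rightarrow> 'a" where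
  "nmult n a = (\<Sum>i<n. a)"

text \<open>A choice of \<open>a\<^sub>1, \<dots>, a\<^sub>h\<close> in \<open>A\<close>, repetitions allowed, is given by a function on
  the index set \<open>{1..h}\<close> with values in \<open>A\<close>.\<close>

definition sumset :: "nat \<Rightarrow> 'a::comm_monoid_add set \<Rightarrow> 'a set" where
  "sumset h A = {(\<Sum>i=1..h. f i) | f. \<forall>i\<in>{1..h}. f i \<in> A}"

end

theory Submission
  imports Defs
begin

text \<open>The map \<open>n \<mapsto> n a\<close> is additive and strictly increasing, so it suffices to compute
  the \<open>h\<close>-fold sumset of \<open>{0, \<dots>, k - 2, k}\<close> in the natural numbers. By induction on \<open>h\<close> this is
  \<open>{0, \<dots>, h k}\<close> without \<open>h k - 1\<close>.\<close>

lemma nmult_add: "nmult (m + n) a = nmult m a + nmult n a"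
  by (induction n) (simp_all add: nmult_def add_ac)

text \<open>Each further summand \<open>a\<close> is positive, so successive multiples increase.
  This is used for the injectivity of the multiples of \<open>a\<close>.\<close>

lemma strict_mono_nmult:
  fixes a :: "'a::linordered_ab_group_add"
  assumes "0 < a"
  shows "strict_mono (\<lambda>n. nmult n a)"
  using assms by (simp add: strict_mono_Suc_iff nmult_def)

lemma sumset_0: "sumset 0 A = {0}"
  by (auto simp: sumset_def)

lemma sumset_Suc: "sumset (Suc h) A = {x + y | x y. x \<in> sumset h A \<and> y \<in> A}"
proof (intro equalityI subsetI)
  fix z assume "z \<in> sumset (Suc h) A"
  then obtain f where "z = (\<Sum>i=1..Suc h. f i)" "\<forall>i\<in>{1..Suc h}. f i \<in> A"
    unfolding sumset_def by blast
  then have "z = (\<Sum>i=1..h. f i) + f (Suc h)" "\<forall>i\<in>{1..h}. f i \<in> A" "f (Suc h) \<in> A"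
    by simp_all
  then show "z \<in> {x + y | x y. x \<in> sumset h A \<and> y \<in> A}"
    unfolding sumset_def by blast
next
  fix z assume "z \<in> {x + y | x y. x \<in> sumset h A \<and> y \<in> A}"
  then obtain f y where f: "z = (\<Sum>i=1..h. f i) + y" "\<forall>i\<in>{1..h}. f i \<in> A" "y \<in> A"
    unfolding sumset_def by blast
  let ?g = "f(Suc h := y)"
  have "z = (\<Sum>i=1..Suc h. ?g i)"
    using f by simp
  moreover have "\<forall>i\<in>{1..Suc h}. ?g i \<in> A"
    using f by (auto simp: le_Suc_eq)
  ultimately show "z \<in> sumset (Suc h) A"
    unfolding sumset_def by blast
qed

text \<open>Additivity moves \<open>f\<close> through a sum one summand at a time, and
  \<open>f 0 = 0\<close> settles the empty sum. With \<open>f\<close> the multiples of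
  \<open>a\<close>, the count passes from the group to the natural numbers.\<close>

lemma sumset_image:
  assumes "f 0 = 0" and add: "\<And>x y. f (x + y) = f x + f y"
  shows "sumset h (f ` A) = f ` sumset h A"
proof (induction h)
  case 0
  then show ?case using assms by (simp add: sumset_0)
next
  case (Suc h)
  show ?case
    unfolding sumset_Suc Suc.IH by (auto simp: image_iff add[symmetric]) (metis add)+
qed

text \<open>Every summand falls short of \<open>k\<close> by an amount other than 1, and such
  shortfalls never add up to exactly 1; hence the gap at \<open>h * k - 1\<close>. All other values
  up to \<open>h * k\<close> are reached.\<close>

lemma sumset_interval_gap:
  fixes k h :: nat
  assumes k: "k \<ge> 3" and "h \<ge> 1"
  shows "sumset h ({..k} - {k - 1}) = {..h * k} - {h * k - 1}"
  using \<open>h \<ge> 1\<close>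
\<comment> \<open>The start is \<open>h = 1\<close>: at \<open>h = 0\<close> truncated subtraction
  would make the right-hand side empty, while the sumset is \<open>{0}\<close>.\<close>
proof (induction h rule: dec_induct)
  case base
  show ?case by (auto simp: sumset_Suc sumset_0)
next
  case (step h)
  define m where "m = h * k"
  have m: "k \<le> m" "Suc h * k = m + k"
    using step.hyps by (simp_all add: m_def)
  show ?case
    unfolding sumset_Suc step.IH m(2) m_def[symmetric]
  proof (intro equalityI subsetI)
    fix z assume "z \<in> {x + y | x y. x \<in> {..m} - {m - 1} \<and> y \<in> {..k} - {k - 1}}"
    then show "z \<in> {..m + k} - {m + k - 1}"
      using m(1) k by auto
  next
    fix z assume z: "z \<in> {..m + k} - {m + k - 1}"
    consider "z \<ge> k" | "z = k - 1" | "z < k - 1" by linarith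
    then have "\<exists>x y. z = x + y \<and> x \<in> {..m} - {m - 1} \<and> y \<in> {..k} - {k - 1}"
    proof cases
      case 1
      \<comment> \<open>Removing \<open>k\<close> leaves \<open>z - k\<close>, which avoids
        \<open>m - 1\<close> because \<open>z\<close> avoids \<open>m + k - 1\<close>.\<close>
      then show ?thesis using z m(1) k by - (rule exI[of _ "z - k"], rule exI[of _ k], auto)
    next
      case 2
      \<comment> \<open>The value \<open>k - 1\<close> is itself the gap, so it is split as
        \<open>1 + (k - 2)\<close>; here \<open>m \<ge> 3\<close> gives
        \<open>1 \<noteq> m - 1\<close>.\<close>
      then show ?thesis using m(1) k by - (rule exI[of _ 1], rule exI[of _ "k - 2"], auto)
    next
      case 3
      then show ?thesis using m(1) k by - (rule exI[of _ 0], rule exI[of _ z], auto)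
    qed
    then show "z \<in> {x + y | x y. x \<in> {..m} - {m - 1} \<and> y \<in> {..k} - {k - 1}}"
      by blast
  qed
qed

theorem theorem3p7:
  fixes a :: "'a::linordered_ab_group_add" and A :: "'a set" and h k :: nat
  assumes "0 < a" and "h \<ge> 2" and "k \<ge> 3"
    and "A = {nmult i a | i. i \<le> k - 2} \<union> {nmult k a}"
  shows "card (sumset h A) = h * k"
proof -
  let ?f = "\<lambda>n. nmult n a"
  have "{..k} - {k - 1} = {..k - 2} \<union> {k}"
    using assms(3) by auto
  then have "A = ?f ` ({..k} - {k - 1})"
    unfolding assms(4) by auto
  then have "sumset h A = ?f ` sumset h ({..k} - {k - 1})"
    by (simp only:) (rule sumset_image, simp_all add: nmult_add, simp add: nmult_def)
  also have "\<dots> = ?f ` ({..h * k} - {h * k - 1})"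
    using assms by (subst sumset_interval_gap) simp_all
  finally have "card (sumset h A) = card ({..h * k} - {h * k - 1})"
    using strict_mono_imp_inj_on[OF strict_mono_nmult[OF assms(1)]]
    by (simp add: card_image inj_on_subset)
  \<comment> \<open>The interval has \<open>h * k + 1\<close> elements, and the removed point is one
    of them.\<close>
  then show ?thesis
    by simp
qed

end
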